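(* Let $\mathcal{A}$ be a finite affine hyperplane arrangement in $\mathbb{R}^\ell$ with a generic flag $\mathcal{F}$ and defining affine forms $h_1,\dots,h_\ell$ satisfying the standing assumptions listed in the context. If $C\in\mathsf{ch}^q_{\mathcal{F}}(\mathcal{A})$, then $S(C)$ is a contractible $(2\ell-q)$-dimensional manifold.
   Context: Arrangement: $\mathcal{A}=\{H_1,\dots,H_n\}$ is a finite set of affine hyperplanes in $\mathbb{R}^\ell$. $L(\mathcal{A})$ is the set of nonempty intersections of elements of $\mathcal{A}$ (including $\mathbb{R}^\ell$, the empty intersection). $\mathsf{ch}(\mathcal{A})$ is the set of chambers, i.e. connected components of $\mathbb{R}^\ell\setminus\bigcup_{H\in\mathcal{A}}H$. $\tau(X)$ is the linear subspace through the origin parallel to an affine subspace $X\subset\mathbb{R}^\ell$ with $\dim\tau(X)=\dim X$. Flag: $\mathcal{F}:\emptyset=\mathcal{F}^{-1}\subset\mathcal{F}^0\subset\cdots\subset\mathcal{F}^\ell=\mathbb{R}^\ell$ is a generic flag: $\mathcal{F}^q$ is a $q$-dimensional affine subspace with $\dim(\mathcal{F}^q\cap X)=q+\dim X-\ell$ for all $X\in L(\mathcal{A})$ (empty intersection when this number is negative). $h_1,\dots,h_\ell$ are affine linear forms on $\mathbb{R}^\ell$ with $\mathcal{F}^q=\{h_{q+1}=\cdots=h_\ell=0\}$ for $0\le q\le\ell-1$. Put $\mathsf{ch}^q_{\mathcal{F}}(\mathcal{A})=\{C\in\mathsf{ch}(\mathcal{A})\mid C\cap\mathcal{F}^q\ne\emptyset,\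 C\cap\mathcal{F}^{q-1}=\emptyset\}$. Standing assumption, for $q=1,\dots,\ell$: (1) if $C\in\mathsf{ch}^q_{\mathcal{F}}(\mathcal{A})$ then $C\cap\mathcal{F}^q\subset\{h_{q+1}=\cdots=h_\ell=0,\ h_q>0\}$; (2) if $X\neq X'$ in $L(\mathcal{A})$ both have dimension $\ell-q$ (so each meets $\mathcal{F}^q$ in one point), then $h_q(X\cap\mathcal{F}^q)\ne h_q(X'\cap\mathcal{F}^q)$. The subspace $X_C$: for $C\in\mathsf{ch}^q_{\mathcal{F}}(\mathcal{A})$ with $q\ge1$, $\overline{C}\cap\mathcal{F}^q$ is a $q$-dimensional polyhedron on which $h_q$ attains its minimum at a unique vertex $p$; $X_C$ is the unique element of $L(\mathcal{A})$ with $X_C\cap\mathcal{F}^q=\{p\}$ (so $\dim X_C=\ell-q$). For $q=0$, $X_C=\mathbb{R}^\ell$. For points $p_1,p_2\in\mathbb{R}^\ell$, $\mathrm{Sep}(p_1,p_2)=\{H\in\mathcal{A}\mid[p_1,p_2]\cap H\ne\emptyset\}$, where $[p_1,p_2]$ is the closed line segment. The set $S(C)$: for each $q$ and $C\in\mathsf{ch}^q_{\mathcal{F}}(\mathcal{A})$ fix a base point $p_C\in C\cap\mathcal{F}^q$ (the constructions do not depend on the choice), and define $$S(C)=\{x+\sqrt{-1}\,v\in\mathbb{C}^\ell\mid x\in\mathbb{R}^\ell,\ v\in\tau(X_C),\ v\notin\tau(H)\text{ for all }H\in\mathrm{Sep}(p_C,x)\}.$$ *)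

theory Defs
  imports "HOL-Analysis.Analysis"
begin

definition hyperplane_arrangement :: "(real ^ 'n) set set \<Rightarrow> bool" where
  "hyperplane_arrangement A \<longleftrightarrow>
     finite A \<and> (\<forall>H\<in>A. \<exists>a b. a \<noteq> 0 \<and> H = {x. a \<bullet> x = b})"

text \<open>The empty intersection is the whole space: \<open>\<Inter>{} = UNIV\<close>.\<close>

definition intersections :: "(real ^ 'n) set set \<Rightarrow> (real ^ 'n) set set" where
  "intersections A = {\<Inter>B | B. B \<subseteq> A \<and> \<Inter>B \<noteq> {}}"

definition chambers :: "(real ^ 'n) set set \<Rightarrow> (real ^ 'n) set set" where
  "chambers A = components (UNIV - \<Union>A)"

definition direction :: "(real ^ 'n) set \<Rightarrow> (real ^ 'n) set" where
  "direction X = (THE V. subspace V \<and> affine_parallel V X)"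

definition Sep :: "(real ^ 'n) set set \<Rightarrow> real ^ 'n \<Rightarrow> real ^ 'n \<Rightarrow> (real ^ 'n) set set" where
  "Sep A p1 p2 = {H \<in> A. closed_segment p1 p2 \<inter> H \<noteq> {}}"

text \<open>A flag is a sequence \<open>F :: nat \<Rightarrow> (real ^ 'n) set\<close>, of which only the members
  \<open>F 0, \<dots>, F CARD('n)\<close> matter. The member of index \<open>-1\<close>, which is empty, is supplied by
  \<open>flag_pred F 0\<close>.\<close>

definition flag_pred :: "(nat \<Rightarrow> (real ^ 'n) set) \<Rightarrow> nat \<Rightarrow> (real ^ 'n) set" where
  "flag_pred F q = (case q of 0 \<Rightarrow> {} | Suc k \<Rightarrow> F k)"

definition generic_flag :: "(real ^ 'n) set set \<Rightarrow> (nat \<Rightarrow> (real ^ 'n) set) \<Rightarrow> bool" where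
  "generic_flag A F \<longleftrightarrow>
     (\<forall>q \<le> CARD('n). affine (F q) \<and> aff_dim (F q) = int q) \<and>
     (\<forall>q \<le> CARD('n). flag_pred F q \<subset> F q) \<and>
     F CARD('n) = UNIV \<and>
     (\<forall>q \<le> CARD('n). \<forall>X \<in> intersections A.
        (let d = int q + aff_dim X - int CARD('n)
         in if d < 0 then F q \<inter> X = {} else aff_dim (F q \<inter> X) = d))"

definition flag_zero_set :: "(nat \<Rightarrow> real ^ 'n \<Rightarrow> real) \<Rightarrow> nat \<Rightarrow> (real ^ 'n) set" where
  "flag_zero_set h q = {x. \<forall>i \<in> {q + 1..CARD('n)}. h i x = 0}"

definition flag_forms :: "(nat \<Rightarrow> (real ^ 'n) set) \<Rightarrow> (nat \<Rightarrow> real ^ 'n \<Rightarrow> real) \<Rightarrow> bool" where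
  "flag_forms F h \<longleftrightarrow>
     (\<forall>i \<in> {1..CARD('n)}. \<exists>f c. linear f \<and> h i = (\<lambda>x. f x + c)) \<and>
     (\<forall>q < CARD('n). F q = flag_zero_set h q)"

definition flag_chambers ::
  "(real ^ 'n) set set \<Rightarrow> (nat \<Rightarrow> (real ^ 'n) set) \<Rightarrow> nat \<Rightarrow> (real ^ 'n) set set" where
  "flag_chambers A F q = {C \<in> chambers A. C \<inter> F q \<noteq> {} \<and> C \<inter> flag_pred F q = {}}"

text \<open>In the second condition both \<open>X \<inter> F q\<close> and \<open>X' \<inter> F q\<close> are single points, so the
  images compared are singletons.\<close>

definition admissible_flag_forms ::
  "(real ^ 'n) set set \<Rightarrow> (nat \<Rightarrow> (real ^ 'n) set) \<Rightarrow> (nat \<Rightarrow> real ^ 'n \<Rightarrow> real) \<Rightarrow> bool" where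
  "admissible_flag_forms A F h \<longleftrightarrow>
     (\<forall>q \<in> {1..CARD('n)}.
        (\<forall>C \<in> flag_chambers A F q. C \<inter> F q \<subseteq> flag_zero_set h q \<inter> {x. h q x > 0}) \<and>
        (\<forall>X \<in> intersections A. \<forall>X' \<in> intersections A.
           X \<noteq> X' \<and> aff_dim X = int CARD('n) - int q \<and> aff_dim X' = int CARD('n) - int q
           \<longrightarrow> h q ` (X \<inter> F q) \<noteq> h q ` (X' \<inter> F q)))"

definition min_vertex ::
  "(nat \<Rightarrow> (real ^ 'n) set) \<Rightarrow> (nat \<Rightarrow> real ^ 'n \<Rightarrow> real) \<Rightarrow> nat \<Rightarrow> (real ^ 'n) set \<Rightarrow> real ^ 'n" where
  "min_vertex F h q C =
     (THE p. p extreme_point_of (closure C \<inter> F q) \<and>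
             (\<forall>y \<in> closure C \<inter> F q. h q p \<le> h q y))"

definition chamber_subspace ::
  "(real ^ 'n) set set \<Rightarrow> (nat \<Rightarrow> (real ^ 'n) set) \<Rightarrow> (nat \<Rightarrow> real ^ 'n \<Rightarrow> real) \<Rightarrow> nat
     \<Rightarrow> (real ^ 'n) set \<Rightarrow> (real ^ 'n) set" where
  "chamber_subspace A F h q C =
     (if q = 0 then UNIV
      else (THE X. X \<in> intersections A \<and> X \<inter> F q = {min_vertex F h q C}))"

definition complex_point :: "real ^ 'n \<Rightarrow> real ^ 'n \<Rightarrow> complex ^ 'n" where
  "complex_point x v = (\<chi> i. of_real (x $ i) + \<i> * of_real (v $ i))"

text \<open>\<open>p\<close> is the base point of the chamber \<open>C\<close>.\<close>

definition stratum ::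
  "(real ^ 'n) set set \<Rightarrow> (nat \<Rightarrow> (real ^ 'n) set) \<Rightarrow> (nat \<Rightarrow> real ^ 'n \<Rightarrow> real) \<Rightarrow> nat
     \<Rightarrow> (real ^ 'n) set \<Rightarrow> real ^ 'n \<Rightarrow> (complex ^ 'n) set" where
  "stratum A F h q C p =
     {complex_point x v | x v.
        v \<in> direction (chamber_subspace A F h q C) \<and> (\<forall>H \<in> Sep A p x. v \<notin> direction H)}"

definition topological_manifold :: "nat \<Rightarrow> 'a topology \<Rightarrow> bool" where
  "topological_manifold m X \<longleftrightarrow>
     Hausdorff_space X \<and> second_countable X \<and>
     (\<forall>x \<in> topspace X. \<exists>U V. openin X U \<and> x \<in> U \<and> openin (Euclidean_space m) V \<and>
        subtopology X U homeomorphic_space subtopology (Euclidean_space m) V)"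

end

theory Submission
  imports Defs
begin

text \<open>Orient every hyperplane \<open>H = {x. a H \<bullet> x = b H}\<close> so that \<open>p\<close> lies on its positive side. Then
  \<open>H\<close> separates \<open>p\<close> from \<open>x\<close> iff \<open>a H \<bullet> x \<le> b H\<close>, so with \<open>T\<close> the direction of the subspace
  attached to the chamber, the stratum is the set of all \<open>(x, v)\<close> with \<open>v \<in> T\<close> such that
  \<open>a H \<bullet> x > b H\<close> or \<open>a H \<bullet> v \<noteq> 0\<close> for each \<open>H\<close>. This is open in a linear space of dimension
  \<open>n + dim T\<close>, and moving \<open>x\<close> straight to \<open>p\<close> only removes conditions on \<open>v\<close>; at \<open>x = p\<close> the fibre is
  all of \<open>T\<close>. That \<open>dim T = n - q\<close> rests on the section of the closed chamber by the flag
  having exactly one vertex at which \<open>h q\<close> is minimal: existence is a descent along faces, on which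
  genericity keeps \<open>h q\<close> from being constant, and uniqueness is the second admissibility condition.\<close>

section \<open>Vertices of polyhedra and linear minimization\<close>

text \<open>The smallest member of the intersection lattice through \<open>x\<close>; it is the
  whole space when no hyperplane contains \<open>x\<close>.\<close>

definition flat :: "'a set set \<Rightarrow> 'a \<Rightarrow> 'a set" where
  "flat A x = \<Inter>{H \<in> A. x \<in> H}"

lemma in_flat: "y \<in> flat A x \<longleftrightarrow> (\<forall>H\<in>A. x \<in> H \<longrightarrow> y \<in> H)"
  by (auto simp: flat_def)

lemma affine_line_mem:
  assumes "affine E" "x \<in> E" "u \<in> E"
  shows "x + t *\<^sub>R (u - x) \<in> E"
proof -
  have "(1 - t) *\<^sub>R x + t *\<^sub>R u \<in> E"
    using assms unfolding affine_alt by blast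
  then show ?thesis by (simp add: algebra_simps)
qed

text \<open>A fixed equation is chosen for each hyperplane because its sign singles out a side;
  later this is the side of the base point.\<close>

locale halfspace_system =
  fixes A :: "'a::euclidean_space set set" and a :: "'a set \<Rightarrow> 'a" and b :: "'a set \<Rightarrow> real"
  assumes finite_A: "finite A"
    and hyperplane: "H \<in> A \<Longrightarrow> H = {x. a H \<bullet> x = b H}"
begin

definition region :: "'a set" where
  "region = {x. \<forall>H\<in>A. b H \<le> a H \<bullet> x}"

definition open_region :: "'a set" where
  "open_region = {x. \<forall>H\<in>A. b H < a H \<bullet> x}"

lemma mem_hyperplane: "H \<in> A \<Longrightarrow> x \<in> H \<longleftrightarrow> a H \<bullet> x = b H"
  using hyperplane[of H] by (metis (mono_tags, lifting) mem_Collect_eq)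

lemma flat_direction:
  assumes "u \<in> flat A x" "H \<in> A" "x \<in> H"
  shows "a H \<bullet> (u - x) = 0"
  using assms mem_hyperplane[OF assms(2)] by (auto simp: in_flat inner_diff_right)

text \<open>Sliding along a direction in which the linear form decreases must leave the region; at the
  exit point a further hyperplane is met.\<close>

lemma exists_vertex_le:
  fixes f :: "'a \<Rightarrow> real"
  assumes E: "affine E" and f: "linear f"
    and nonneg: "\<And>y. y \<in> region \<inter> E \<Longrightarrow> 0 \<le> f y + c"
    and nonconst: "\<And>y. y \<in> region \<inter> E \<Longrightarrow> flat A y \<inter> E \<noteq> {y} \<Longrightarrow> \<exists>u \<in> flat A y \<inter> E. f u \<noteq> f y"
    and x: "x \<in> region \<inter> E"
  shows "\<exists>y \<in> region \<inter> E. flat A y \<inter> E = {y} \<and> f y \<le> f x"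
  using x
\<comment> \<open>The measure counts the hyperplanes that miss \<open>x\<close>: each slide keeps
  those through \<open>x\<close> and gains at least one more.\<close>
proof (induction "card {H \<in> A. x \<notin> H}" arbitrary: x rule: less_induct)
  case (less x)
  show ?case
  proof (cases "flat A x \<inter> E = {x}")
    case True
    with less.prems show ?thesis by (intro bexI[of _ x]) auto
  next
    case False
    then obtain u where u: "u \<in> flat A x \<inter> E" "f u \<noteq> f x"
      using nonconst less.prems by blast
    \<comment> \<open>The point \<open>u\<close> gives a direction inside the flat, with the sign
      chosen so that \<open>f\<close> decreases.\<close>
    define d where "d = (if f u < f x then u - x else x - u)"
    have fd: "f d < 0"
      using u(2) by (auto simp: d_def linear_diff[OF f])
    have line: "x + t *\<^sub>R d \<in> E" for t
    proof -
      have "x + t *\<^sub>R (u - x) \<in> E" "x + (- t) *\<^sub>R (u - x) \<in> E"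
        using affine_line_mem[OF E] u(1) less.prems by blast+
      then show ?thesis
        by (auto simp: d_def algebra_simps)
    qed
    have ad: "a H \<bullet> d = 0" if "H \<in> A" "x \<in> H" for H
      using flat_direction[of u x H] u(1) that by (auto simp: d_def inner_diff_right)
    have f_line: "f (x + t *\<^sub>R d) = f x + t * f d" for t
      by (simp add: linear_add[OF f] linear_scale[OF f])
    \<comment> \<open>\<open>N\<close> collects the hyperplanes that the ray approaches, and
      \<open>r H\<close> is the time at which it reaches \<open>H\<close>.\<close>
    define N where "N = {H \<in> A. a H \<bullet> d < 0}"
    define r where "r H = (a H \<bullet> x - b H) / - (a H \<bullet> d)" for H
    have finN: "finite N"
      using finite_A by (simp add: N_def)
    have xr: "b H \<le> a H \<bullet> x" if "H \<in> A" for H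
      using less.prems that by (auto simp: region_def)
    have "N \<noteq> {}"
    proof
      assume "N = {}"
      then have ge: "0 \<le> a H \<bullet> d" if "H \<in> A" for H
        using that by (force simp: N_def)
      \<comment> \<open>If nothing were approached, the whole ray would stay in the region, and at
        this time \<open>f + c\<close> would equal -1.\<close>
      define t where "t = (f x + c + 1) / - f d"
      have "0 \<le> f x + c"
        using nonneg less.prems by blast
      then have t: "0 \<le> t"
        using fd by (simp add: t_def divide_nonneg_neg)
      have "x + t *\<^sub>R d \<in> region"
        using xr ge t by (auto simp: region_def inner_add_right intro: add_increasing2)
      then have "0 \<le> f x + t * f d + c"
        using nonneg[of "x + t *\<^sub>R d"] line f_line by auto
      moreover have "t * f d = - (f x + c + 1)"
        using fd by (simp add: t_def)
      ultimately show False by simp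
    qed
    \<comment> \<open>At the first hitting time every inequality still holds, and the one for
      \<open>K\<close> has become an equality.\<close>
    define t where "t = Min (r ` N)"
    have "t \<in> r ` N"
      unfolding t_def using finN \<open>N \<noteq> {}\<close> by (intro Min_in) auto
    then obtain K where K: "K \<in> N" "t = r K" by blast
    have t_le: "t \<le> r H" if "H \<in> N" for H
      unfolding t_def using that finN by (intro Min_le) auto
    have t0: "0 \<le> t"
      using K xr[of K] by (auto simp: r_def N_def intro!: divide_nonneg_neg)
    define y where "y = x + t *\<^sub>R d"
    have "b H \<le> a H \<bullet> y" if H: "H \<in> A" for H
    proof (cases "H \<in> N")
      case True
      then have "t * - (a H \<bullet> d) \<le> a H \<bullet> x - b H"
        using t_le[OF True] by (auto simp: r_def N_def field_simps)
      then show ?thesis by (simp add: y_def inner_add_right)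
    next
      case False
      then show ?thesis
        using t0 xr H by (auto simp: y_def N_def inner_add_right intro: add_increasing2)
    qed
    then have y: "y \<in> region \<inter> E"
      using line by (auto simp: region_def y_def)
    have "K \<in> A" "a K \<bullet> d < 0"
      using K by (auto simp: N_def)
    moreover have "t * (a K \<bullet> d) = - (a K \<bullet> x - b K)"
      using \<open>a K \<bullet> d < 0\<close> K(2) by (simp add: r_def)
    ultimately have yK: "y \<in> K" and xK: "x \<notin> K"
      using ad[of K] by (auto simp: mem_hyperplane y_def inner_add_right)
    have "{H \<in> A. y \<notin> H} \<subset> {H \<in> A. x \<notin> H}"
    proof
      show "{H \<in> A. y \<notin> H} \<subseteq> {H \<in> A. x \<notin> H}"
        using ad by (auto simp: mem_hyperplane y_def inner_add_right)
      show "{H \<in> A. y \<notin> H} \<noteq> {H \<in> A. x \<notin> H}"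
        using \<open>K \<in> A\<close> yK xK by blast
    qed
    then have "card {H \<in> A. y \<notin> H} < card {H \<in> A. x \<notin> H}"
      using finite_A by (intro psubset_card_mono) auto
    from less.hyps[OF this y] obtain z
      where "z \<in> region \<inter> E" "flat A z \<inter> E = {z}" "f z \<le> f y"
      by blast
    moreover have "f y \<le> f x"
      using t0 fd by (simp add: y_def f_line mult_nonneg_nonpos)
    ultimately show ?thesis by (meson order_trans)
  qed
qed

text \<open>A vertex is determined by the hyperplanes through it, so there are finitely many. Every
  point lies above some vertex in \<open>f\<close>-value, hence the best vertex minimizes
  \<open>f\<close> everywhere.\<close>

lemma exists_minimal_vertex:
  fixes f :: "'a \<Rightarrow> real"
  assumes E: "affine E" and f: "linear f"
    and nonneg: "\<And>y. y \<in> region \<inter> E \<Longrightarrow> 0 \<le> f y + c"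
    and nonconst: "\<And>y. y \<in> region \<inter> E \<Longrightarrow> flat A y \<inter> E \<noteq> {y} \<Longrightarrow> \<exists>u \<in> flat A y \<inter> E. f u \<noteq> f y"
    and ne: "region \<inter> E \<noteq> {}"
  shows "\<exists>y \<in> region \<inter> E. flat A y \<inter> E = {y} \<and> (\<forall>x \<in> region \<inter> E. f y \<le> f x)"
proof -
  define V where "V = {y \<in> region \<inter> E. flat A y \<inter> E = {y}}"
  have desc: "\<exists>y\<in>V. f y \<le> f x" if "x \<in> region \<inter> E" for x
    using exists_vertex_le[OF E f nonneg nonconst that] by (auto simp: V_def)
  have inj: "inj_on (\<lambda>y. {H \<in> A. y \<in> H}) V"
  proof (rule inj_onI)
    fix y z assume "y \<in> V" "z \<in> V" and eq: "{H \<in> A. y \<in> H} = {H \<in> A. z \<in> H}"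
    then have "{y} = flat A y \<inter> E" "{z} = flat A z \<inter> E"
      unfolding V_def by blast+
    moreover have "flat A y = flat A z"
      unfolding flat_def eq ..
    ultimately have "{y} = {z}" by argo
    then show "y = z" by blast
  qed
  have "(\<lambda>y. {H \<in> A. y \<in> H}) ` V \<subseteq> Pow A"
    by auto
  then have "finite ((\<lambda>y. {H \<in> A. y \<in> H}) ` V)"
    using finite_A by (meson finite_Pow_iff finite_subset)
  then have "finite V"
    using inj by (rule finite_imageD)
  moreover have "V \<noteq> {}"
    using ne desc by blast
  ultimately have "arg_min_on f V \<in> V" "\<And>z. z \<in> V \<Longrightarrow> f (arg_min_on f V) \<le> f z"
    by (auto intro: arg_min_if_finite(1) arg_min_least)
  moreover have "f (arg_min_on f V) \<le> f x" if "x \<in> region \<inter> E" for x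
    using desc[OF that] calculation(2) order_trans by blast
  ultimately show ?thesis
    unfolding V_def by blast
qed

text \<open>A second point of the flat in \<open>E\<close> would allow small moves from
  \<open>x\<close> in two opposite directions. Conversely, an inequality that is tight inside a
  segment of the region is tight at both ends.\<close>

lemma extreme_point_iff_flat:
  assumes E: "affine E"
  shows "x extreme_point_of (region \<inter> E) \<longleftrightarrow> x \<in> region \<inter> E \<and> flat A x \<inter> E = {x}"
proof safe
  fix y
  assume ext: "x extreme_point_of (region \<inter> E)" and y: "y \<in> flat A x" "y \<in> E"
  then have x: "x \<in> region" "x \<in> E"
    by (auto simp: extreme_point_of_def)
  define d where "d = y - x"
  have ad: "a H \<bullet> d = 0" if "H \<in> A" "x \<in> H" for H
    using flat_direction[of y x H] y that by (auto simp: d_def)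
  \<comment> \<open>The strict inequalities at \<open>x\<close> persist on a ball, whose radius
    bounds the admissible moves along \<open>d\<close>.\<close>
  define U where "U = {z. \<forall>H \<in> {H \<in> A. x \<notin> H}. b H < a H \<bullet> z}"
  have "U = (\<Inter>H \<in> {H \<in> A. x \<notin> H}. {z. b H < a H \<bullet> z})"
    by (auto simp: U_def)
  then have "open U"
    using finite_A by (auto intro!: open_INT open_halfspace_gt)
  moreover have "x \<in> U"
    using x by (force simp: U_def region_def mem_hyperplane)
  ultimately obtain e where e: "0 < e" "cball x e \<subseteq> U"
    by (meson open_contains_cball)
  show "y = x"
  proof (rule ccontr)
    assume "y \<noteq> x"
    define s where "s = e / norm d"
    have s: "0 < s" "s * norm d = e"
      using \<open>y \<noteq> x\<close> e by (auto simp: s_def d_def)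
    have mem: "x + t *\<^sub>R d \<in> region \<inter> E" if "\<bar>t\<bar> = s" for t
    proof -
      have "x + t *\<^sub>R d \<in> U"
        using e s that by (auto simp: dist_norm intro!: subsetD[OF e(2)])
      moreover have "b H \<le> a H \<bullet> (x + t *\<^sub>R d)" if "H \<in> A" "x \<in> H" for H
        using that ad by (auto simp: inner_add_right mem_hyperplane)
      ultimately have "x + t *\<^sub>R d \<in> region"
        unfolding region_def U_def by force
      then show ?thesis
        using affine_line_mem[OF E \<open>x \<in> E\<close> y(2)] by (simp add: d_def)
    qed
    have "x + s *\<^sub>R d \<in> region \<inter> E" "x + (- s) *\<^sub>R d \<in> region \<inter> E"
      using mem[of s] mem[of "- s"] s(1) by auto
    moreover have "x \<in> open_segment (x + s *\<^sub>R d) (x + (- s) *\<^sub>R d)"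
    proof -
      have "x = midpoint (x + s *\<^sub>R d) (x + (- s) *\<^sub>R d)"
        by (simp add: midpoint_def flip: scaleR_2)
      moreover have "x + s *\<^sub>R d \<noteq> x + (- s) *\<^sub>R d"
        unfolding add_left_cancel scaleR_cancel_right using s(1) \<open>y \<noteq> x\<close> by (simp add: d_def)
      ultimately show ?thesis
        by (metis midpoint_in_open_segment)
    qed
    ultimately show False
      using ext unfolding extreme_point_of_def by blast
  qed
next
  assume x: "x \<in> region" "x \<in> E" and sing: "flat A x \<inter> E = {x}"
  have "x \<notin> open_segment y z" if yz: "y \<in> region \<inter> E" "z \<in> region \<inter> E" for y z
  proof
    assume seg: "x \<in> open_segment y z"
    then obtain t where t: "0 < t" "t < 1" and xt: "x = (1 - t) *\<^sub>R y + t *\<^sub>R z" and "y \<noteq> z"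
      by (auto simp: in_segment)
    have "y \<in> H" "z \<in> H" if H: "H \<in> A" "x \<in> H" for H
    proof -
      have ge: "0 \<le> a H \<bullet> y - b H" "0 \<le> a H \<bullet> z - b H"
        using yz H by (auto simp: region_def)
      have "a H \<bullet> x = b H"
        using H by (simp add: mem_hyperplane)
      then have sum0: "(1 - t) * (a H \<bullet> y - b H) + t * (a H \<bullet> z - b H) = 0"
        by (simp add: xt inner_add_right algebra_simps)
      \<comment> \<open>Two nonnegative terms with sum 0 both vanish.\<close>
      have "(1 - t) * (a H \<bullet> y - b H) = 0 \<and> t * (a H \<bullet> z - b H) = 0"
        using sum0 ge t by (subst (asm) add_nonneg_eq_0_iff) auto
      then show "y \<in> H" "z \<in> H"
        using t H by (auto simp: mem_hyperplane)
    qed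
    then have "y \<in> flat A x \<inter> E" "z \<in> flat A x \<inter> E"
      using yz by (auto simp: in_flat)
    then show False
      using sing \<open>y \<noteq> z\<close> by auto
  qed
  then show "x extreme_point_of (region \<inter> E)"
    using x by (auto simp: extreme_point_of_def)
next
  assume "x extreme_point_of (region \<inter> E)"
  then show "x \<in> region" "x \<in> E" "x \<in> flat A x" "x \<in> E"
    by (auto simp: extreme_point_of_def in_flat)
qed

section \<open>Chambers as open polyhedra and their closures\<close>

lemma region_segment_open:
  assumes "p \<in> open_region" "x \<in> region" "0 \<le> t" "t < 1"
  shows "p + t *\<^sub>R (x - p) \<in> open_region"
proof -
  have "b H < a H \<bullet> (p + t *\<^sub>R (x - p))" if "H \<in> A" for H
  proof -
    have "0 < (1 - t) * (a H \<bullet> p - b H)"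
      using assms that by (auto simp: open_region_def)
    moreover have "0 \<le> t * (a H \<bullet> x - b H)"
      using assms that by (auto simp: region_def)
    ultimately show ?thesis
      by (simp add: algebra_simps)
  qed
  then show ?thesis by (simp add: open_region_def)
qed

text \<open>The sequence is kept on the line through \<open>p\<close> and \<open>x\<close> so that
  it stays in every affine subspace containing both points. This carries limits over to the sections
  by the flag.\<close>

lemma region_limit:
  assumes "p \<in> open_region" "x \<in> region"
  shows "\<exists>X. (\<forall>n. X n \<in> open_region \<and> (\<exists>t. X n = p + t *\<^sub>R (x - p))) \<and> X \<longlonglongrightarrow> x"
proof -
  define X where "X n = p + (1 - inverse (real (Suc n))) *\<^sub>R (x - p)" for n
  have "X n \<in> open_region" for n
    unfolding X_def using assms by (intro region_segment_open) (auto simp: field_simps)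
  moreover have "\<exists>t. X n = p + t *\<^sub>R (x - p)" for n
    by (auto simp: X_def)
  moreover have "X \<longlonglongrightarrow> p + (1 - 0) *\<^sub>R (x - p)"
    unfolding X_def by (intro tendsto_intros LIMSEQ_inverse_real_of_nat)
  ultimately show ?thesis by (intro exI[of _ X]) auto
qed

lemma closure_open_region:
  assumes "p \<in> open_region"
  shows "closure open_region = region"
proof
  have "region = (\<Inter>H\<in>A. {x. b H \<le> a H \<bullet> x})"
    by (auto simp: region_def)
  then have "closed region"
    by (auto intro!: closed_halfspace_ge)
  moreover have "open_region \<subseteq> region"
    by (auto simp: region_def open_region_def intro: less_imp_le)
  ultimately show "closure open_region \<subseteq> region"
    by (rule closure_minimal[rotated])
  show "region \<subseteq> closure open_region"
  proof
    fix x assume "x \<in> region"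
    then obtain X where "\<forall>n. X n \<in> open_region" "X \<longlonglongrightarrow> x"
      using region_limit[OF assms] by blast
    then show "x \<in> closure open_region"
      unfolding closure_sequential by blast
  qed
qed

text \<open>A connected set avoiding a hyperplane cannot change sides, by the intermediate value
  theorem; conversely, the open region is convex, so it lies inside the component of
  \<open>p\<close>.\<close>

lemma component_eq_open_region:
  assumes C: "C \<in> components (UNIV - \<Union>A)" and p: "p \<in> C" "p \<in> open_region"
  shows "C = open_region"
proof
  have "connected C" "C \<subseteq> UNIV - \<Union>A"
    using C in_components_connected in_components_subset by blast+
  show "C \<subseteq> open_region"
  proof
    fix x assume "x \<in> C"
    have "b H < a H \<bullet> x" if H: "H \<in> A" for H
    proof (rule ccontr)
      assume "\<not> b H < a H \<bullet> x"
      moreover have "b H < a H \<bullet> p"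
        using p H by (auto simp: open_region_def)
      ultimately obtain z where "z \<in> C" "a H \<bullet> z = b H"
        using connected_ivt_hyperplane[OF \<open>connected C\<close> \<open>x \<in> C\<close> p(1), of "a H" "b H"] by force
      then show False
        using \<open>C \<subseteq> UNIV - \<Union>A\<close> H by (auto simp: mem_hyperplane)
    qed
    then show "x \<in> open_region" by (simp add: open_region_def)
  qed
  have "open_region = (\<Inter>H\<in>A. {x. b H < a H \<bullet> x})"
    by (auto simp: open_region_def)
  then have "convex open_region"
    by (auto intro!: convex_INT convex_halfspace_gt)
  moreover have "open_region \<subseteq> UNIV - \<Union>A"
    by (auto simp: open_region_def mem_hyperplane)
  ultimately show "open_region \<subseteq> C"
    using components_maximal[OF C] p convex_connected by blast
qed

end

section \<open>Open subsets of linear subspaces are manifolds\<close>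

lemma Euclidean_space_eq_top_of_set: "Euclidean_space m = top_of_set {x. \<forall>i\<ge>m. x i = 0}"
  by (simp add: Euclidean_space_def euclidean_product_topology)

lemma second_countable_euclidean:
  "second_countable (euclidean :: 'a::second_countable_topology topology)"
proof -
  obtain \<B> :: "'a set set" where "countable \<B>" "\<And>C. C \<in> \<B> \<Longrightarrow> open C"
    "\<And>S. open S \<Longrightarrow> \<exists>U. U \<subseteq> \<B> \<and> S = \<Union>U"
    using univ_second_countable by blast
  then show ?thesis
    unfolding second_countable_def by (metis Sup_upper UnionE open_openin subset_iff)
qed

text \<open>Coordinates in an orthonormal basis give the homeomorphism.\<close>

lemma subspace_homeomorphic_Euclidean_space:
  fixes W :: "'a::euclidean_space set"
  assumes "subspace W"
  shows "top_of_set W homeomorphic_space Euclidean_space (dim W)"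
proof -
  obtain B where B: "B \<subseteq> W" "pairwise orthogonal B" "\<And>x. x \<in> B \<Longrightarrow> norm x = 1"
    "independent B" "card B = dim W" "span B = W"
    using orthonormal_basis_subspace[OF assms] by blast
  have "finite B"
    using B(4) independent_imp_finite by blast
  then obtain e where e: "bij_betw e {..<dim W} B"
    using ex_bij_betw_nat_finite[of B] B(5) by (auto simp: atLeast0LessThan)
  have inner_e: "e i \<bullet> e j = (if i = j then 1 else 0)" if "i < dim W" "j < dim W" for i j
  proof -
    have "e i \<in> B" "e j \<in> B" "e i = e j \<longleftrightarrow> i = j"
      using e that by (auto simp: bij_betw_def inj_on_def)
    then show ?thesis
      using B(2,3) by (auto simp: pairwise_def orthogonal_def norm_eq_1)
  qed
  \<comment> \<open>The padding by 0 is forced: points of \<open>Euclidean_space m\<close> are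
    sequences that vanish from index \<open>m\<close> on.\<close>
  define f where "f w i = (if i < dim W then e i \<bullet> w else 0)" for w and i :: nat
  define g where "g x = (\<Sum>i<dim W. x i *\<^sub>R e i)" for x
  have fg: "f (g x) = x" if "\<forall>i\<ge>dim W. x i = 0" for x
  proof
    fix k
    have "e k \<bullet> g x = x k" if k: "k < dim W"
    proof -
      have "e k \<bullet> g x = (\<Sum>i<dim W. if i = k then x k else 0)"
        unfolding g_def inner_sum_right using inner_e k by (intro sum.cong) auto
      then show ?thesis using k by simp
    qed
    then show "f (g x) k = x k"
      using that by (simp add: f_def)
  qed
  have gW: "g x \<in> W" for x
    unfolding g_def using B(1) e
    by (intro subspace_sum[OF assms] subspace_scale[OF assms]) (auto simp: bij_betw_def)
  have gf: "g (f w) = w" if "w \<in> W" for w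
  proof -
    \<comment> \<open>The orthonormal expansion is verified by taking inner products with the basis
      vectors.\<close>
    have "w = (\<Sum>b\<in>B. (b \<bullet> w) *\<^sub>R b)"
    proof (rule vector_eq_dot_span[of _ B])
      show "w \<in> span B" using that B by simp
      show "(\<Sum>b\<in>B. (b \<bullet> w) *\<^sub>R b) \<in> span B"
        by (intro span_sum span_scale span_base)
      fix c assume c: "c \<in> B"
      have "c \<bullet> (\<Sum>b\<in>B. (b \<bullet> w) *\<^sub>R b) = (\<Sum>b\<in>B. if b = c then c \<bullet> w else 0)"
        unfolding inner_sum_right using B(2,3) c
        by (intro sum.cong) (auto simp: pairwise_def orthogonal_def norm_eq_1)
      then show "c \<bullet> w = c \<bullet> (\<Sum>b\<in>B. (b \<bullet> w) *\<^sub>R b)"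
        using c \<open>finite B\<close> by simp
    qed
    also have "\<dots> = g (f w)"
      by (simp add: g_def f_def sum.reindex_bij_betw[OF e, symmetric])
    finally show ?thesis ..
  qed
  have "continuous_map (top_of_set W) (Euclidean_space (dim W)) f"
    unfolding f_def continuous_map_componentwise_Euclidean_space
    by (auto intro!: continuous_intros)
  moreover have "continuous_map (Euclidean_space (dim W)) (top_of_set W) g"
    unfolding Euclidean_space_eq_top_of_set continuous_map_subtopology_eu
      continuous_map_in_subtopology
    using gW by (auto simp: g_def intro!: continuous_intros
        continuous_on_product_coordinates[THEN continuous_on_subset])
  ultimately have "homeomorphic_maps (top_of_set W) (Euclidean_space (dim W)) f g"
    using fg gf by (auto simp: homeomorphic_maps_def topspace_Euclidean_space)
  then show ?thesis
    by (auto simp: homeomorphic_space_def)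
qed

text \<open>One global chart suffices: the coordinates of \<open>W\<close>, restricted to
  \<open>S\<close>, serve at every point.\<close>

lemma topological_manifold_openin_subspace:
  fixes W :: "'a::euclidean_space set"
  assumes W: "subspace W" and S: "openin (top_of_set W) S"
  shows "topological_manifold (dim W) (top_of_set S)"
proof -
  obtain f where f: "homeomorphic_map (top_of_set W) (Euclidean_space (dim W)) f"
    using subspace_homeomorphic_Euclidean_space[OF W] by (auto simp: homeomorphic_space)
  have SW: "S \<subseteq> W"
    using S openin_imp_subset by blast
  have opn: "openin (Euclidean_space (dim W)) (f ` S)"
    using f S homeomorphic_map_openness_eq by blast
  have "f ` (topspace (top_of_set W) \<inter> S) = topspace (Euclidean_space (dim W)) \<inter> f ` S"
    using SW openin_subset[OF opn] by (simp add: Int_absorb1)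
  then have "homeomorphic_map (subtopology (top_of_set W) S)
      (subtopology (Euclidean_space (dim W)) (f ` S)) f"
    using f homeomorphic_map_subtopologies by blast
  moreover have "subtopology (top_of_set W) S = top_of_set S"
    using SW by (simp add: subtopology_subtopology Int_absorb1)
  ultimately have "top_of_set S homeomorphic_space subtopology (Euclidean_space (dim W)) (f ` S)"
    by (metis homeomorphic_map_imp_homeomorphic_space)
  moreover have "second_countable (top_of_set S)"
    by (intro second_countable_subtopology second_countable_euclidean)
  moreover have "Hausdorff_space (top_of_set S)"
    by (intro Hausdorff_space_subtopology) simp
  ultimately show ?thesis
    unfolding topological_manifold_def using opn
    by (auto intro!: exI[of _ S] exI[of _ "f ` S"] simp: subtopology_subtopology)
qed

text \<open>This moves the manifold structure from pairs of real vectors to complex vectors; an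
  injective linear map is a homeomorphism onto its image.\<close>

lemma topological_manifold_linear_image:
  fixes f :: "'a::euclidean_space \<Rightarrow> 'b::euclidean_space"
  assumes f: "linear f" "inj f" and W: "subspace W" and S: "openin (top_of_set W) S"
  shows "topological_manifold (dim W) (top_of_set (f ` S))"
proof -
  obtain g where "homeomorphism (f ` W) W g f"
    using linear_homeomorphism_image[OF f] .
  then have g: "homeomorphism W (f ` W) f g"
    by (rule homeomorphism_symD)
  have "openin (top_of_set (f ` W)) (f ` S)"
    using homeomorphism_imp_open_map[OF g S] .
  then have "topological_manifold (dim (f ` W)) (top_of_set (f ` S))"
    by (intro topological_manifold_openin_subspace linear_subspace_image f W)
  moreover have "dim (f ` W) = dim W"
    by (intro dim_image_eq f(1) inj_on_subset[OF f(2)]) simp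
  ultimately show ?thesis by simp
qed

section \<open>Directions and the subspace attached to a chamber\<close>

text \<open>Two subspaces parallel to the same set are parallel to each other, hence equal, so the
  definite description is met.\<close>

lemma direction_eqI:
  assumes "subspace V" "affine_parallel V X"
  shows "direction X = V"
  unfolding direction_def
proof (rule the_equality)
  fix V' assume "subspace V' \<and> affine_parallel V' X"
  then show "V' = V"
    using assms by (metis affine_parallel_assoc affine_parallel_commute parallel_subspace)
qed (use assms in simp)

lemma direction_hyperplane:
  fixes a :: "real ^ 'n"
  assumes "a \<noteq> 0"
  shows "direction {x. a \<bullet> x = b} = {x. a \<bullet> x = 0}"
proof (rule direction_eqI)
  show "subspace {x. a \<bullet> x = 0}" by (rule subspace_hyperplane)
  show "affine_parallel {x. a \<bullet> x = 0} {x. a \<bullet> x = b}"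
    unfolding affine_parallel_expl using assms
    \<comment> \<open>The translation vector is the point where the normal line through the origin
      meets the hyperplane.\<close>
    by (intro exI[of _ "(b / (a \<bullet> a)) *\<^sub>R a"]) (auto simp: inner_add_right)
qed

lemma direction_affine:
  fixes X :: "(real ^ 'n) set"
  assumes "affine X" "X \<noteq> {}"
  shows "subspace (direction X)" "int (dim (direction X)) = aff_dim X"
proof -
  obtain V where V: "subspace V" "affine_parallel X V"
    using affine_parallel_subspace[OF assms] by blast
  then have "direction X = V"
    by (simp add: direction_eqI affine_parallel_commute)
  then show "subspace (direction X)" "int (dim (direction X)) = aff_dim X"
    using V aff_dim_affine[OF assms(1) V assms(2)] by simp_all
qed

lemma chamber_orientation:
  fixes A :: "(real ^ 'n) set set"
  assumes A: "hyperplane_arrangement A" and p: "p \<notin> \<Union>A"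
  obtains a b where "\<And>H. H \<in> A \<Longrightarrow> a H \<noteq> 0 \<and> H = {x. a H \<bullet> x = b H} \<and> b H < a H \<bullet> p"
proof -
  have "\<exists>c d. c \<noteq> 0 \<and> H = {x. c \<bullet> x = d} \<and> d < c \<bullet> p" if H: "H \<in> A" for H
  proof -
    obtain c d where cd: "c \<noteq> 0" "H = {x. c \<bullet> x = d}"
      using A H by (auto simp: hyperplane_arrangement_def)
    then have "c \<bullet> p \<noteq> d"
      using p H by auto
    then consider "d < c \<bullet> p" | "- d < - c \<bullet> p"
      by fastforce
    then show ?thesis
    proof cases
      case 1
      with cd show ?thesis by blast
    next
      case 2
      with cd show ?thesis by (intro exI[of _ "- c"] exI[of _ "- d"]) auto
    qed
  qed
  then show thesis using that by metis
qed

section \<open>Intersections of hyperplanes and their sections by the flag\<close>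

lemma affine_intersection:
  assumes "hyperplane_arrangement A" "X \<in> intersections A"
  shows "affine X"
proof -
  obtain B where B: "X = \<Inter>B" "B \<subseteq> A"
    using assms by (auto simp: intersections_def)
  have "affine H" if "H \<in> B" for H
    using B(2) that assms(1) by (metis affine_hyperplane hyperplane_arrangement_def subsetD)
  then show ?thesis
    using B by (auto intro: affine_Inter)
qed

lemma flat_in_intersections: "flat A x \<in> intersections A"
  unfolding flat_def intersections_def by blast

text \<open>A point has dimension 0, and genericity then fixes the dimension of
  \<open>X\<close>.\<close>

lemma generic_flag_point_dim:
  fixes A :: "(real ^ 'n) set set"
  assumes "generic_flag A F" "q \<le> CARD('n)" "X \<in> intersections A" "X \<inter> F q = {x}"
  shows "aff_dim X = int CARD('n) - int q"
proof -
  define d where "d = int q + aff_dim X - int CARD('n)"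
  have "if d < 0 then F q \<inter> X = {} else aff_dim (F q \<inter> X) = d"
    using assms unfolding generic_flag_def d_def Let_def by blast
  moreover have "F q \<inter> X = {x}"
    using assms by blast
  ultimately have "d = 0"
    by (auto split: if_splits)
  then show ?thesis by (simp add: d_def)
qed

text \<open>A positive-dimensional section of \<open>X\<close> by the flag also meets the previous member of the
  flag, in one dimension less, so the form that cuts out that member cannot be constant on it.\<close>

lemma flag_form_nonconstant:
  fixes A :: "(real ^ 'n) set set"
  assumes gen: "generic_flag A F" and forms: "flag_forms F h"
    and q: "Suc k \<le> CARD('n)" and X: "X \<in> intersections A"
    and x: "x \<in> X \<inter> F (Suc k)" and ne: "X \<inter> F (Suc k) \<noteq> {x}"
  shows "\<exists>u \<in> X \<inter> F (Suc k). h (Suc k) u \<noteq> h (Suc k) x"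
proof (rule ccontr)
  assume contr: "\<not> ?thesis"
  have dims: "if d < 0 then F q \<inter> X = {} else aff_dim (F q \<inter> X) = d"
    if "q \<le> CARD('n)" "d = int q + aff_dim X - int CARD('n)" for q d
    using that gen X unfolding generic_flag_def Let_def by blast
  define d where "d = int (Suc k) + aff_dim X - int CARD('n)"
  have dim: "aff_dim (F (Suc k) \<inter> X) = d"
    using dims[OF q d_def] x by (auto split: if_splits)
  \<comment> \<open>The section contains \<open>x\<close> but is not \<open>{x}\<close>, so it is
    not a single point.\<close>
  have "aff_dim (F (Suc k) \<inter> X) \<noteq> 0"
    unfolding aff_dim_eq_0 using x ne by (metis Int_commute singletonD)
  moreover have "0 \<le> d"
    using dims[OF q d_def] x by (auto split: if_splits)
  ultimately have "1 \<le> d"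
    using dim by linarith
  have dimk: "aff_dim (F k \<inter> X) = d - 1"
    using dims[of k "d - 1"] q \<open>1 \<le> d\<close> by (auto simp: d_def)
  then have "F k \<inter> X \<noteq> {}"
    using \<open>1 \<le> d\<close> by auto
  then obtain z where z: "z \<in> F k" "z \<in> X" by blast
  have "flag_pred F (Suc k) \<subset> F (Suc k)"
    using gen q unfolding generic_flag_def by blast
  then have sub: "F k \<subseteq> F (Suc k)"
    by (auto simp: flag_pred_def)
  have Fk: "F k = flag_zero_set h k"
    using forms q by (auto simp: flag_forms_def)
  have "h (Suc k) z = 0"
    using z(1) q unfolding Fk flag_zero_set_def by auto
  \<comment> \<open>A constant value must be the value 0 taken at \<open>z\<close>.\<close>
  then have zero: "h (Suc k) u = 0" if "u \<in> X \<inter> F (Suc k)" for u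
    using contr z sub that by (metis IntI subsetD)
  \<comment> \<open>\<open>flag_forms\<close> describes only the members below the top; for the top
    index there are no equations and the zero set is the whole space.\<close>
  have "F (Suc k) \<subseteq> flag_zero_set h (Suc k)"
  proof (cases "Suc k < CARD('n)")
    case True
    then show ?thesis using forms by (auto simp: flag_forms_def)
  next
    case False
    then show ?thesis by (auto simp: flag_zero_set_def)
  qed
  \<comment> \<open>The section therefore equals its intersection with \<open>F k\<close>, although
    their dimensions are \<open>d\<close> and \<open>d - 1\<close>.\<close>
  then have "X \<inter> F (Suc k) \<subseteq> F k"
    using zero unfolding Fk flag_zero_set_def
    by (force simp: Ball_def le_Suc_eq dest: le_neq_implies_less)
  then have "F (Suc k) \<inter> X = F k \<inter> X"
    using sub by blast
  then show False
    using dim dimk by simp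
qed

text \<open>For positive \<open>q\<close>, both definite descriptions are resolved: the minimal
  vertex exists and is unique, and the attached subspace is the flat through it.\<close>

lemma chamber_subspace_props:
  fixes A :: "(real ^ 'n) set set"
  assumes A: "hyperplane_arrangement A" and gen: "generic_flag A F" and forms: "flag_forms F h"
    and adm: "admissible_flag_forms A F h"
    and q: "q \<le> CARD('n)" and C: "C \<in> flag_chambers A F q"
  shows "chamber_subspace A F h q C \<in> intersections A"
    "aff_dim (chamber_subspace A F h q C) = int CARD('n) - int q"
proof -
  have "chamber_subspace A F h q C \<in> intersections A \<and>
    aff_dim (chamber_subspace A F h q C) = int CARD('n) - int q"
  proof (cases q)
    case 0
    have "UNIV \<in> intersections A"
      unfolding intersections_def by (intro CollectI exI[of _ "{}"]) auto
    then show ?thesis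
      using 0 by (simp add: chamber_subspace_def)
  next
    case (Suc k)
    obtain p where p: "p \<in> C" "p \<in> F q" and comp: "C \<in> components (UNIV - \<Union>A)"
      using C by (auto simp: flag_chambers_def chambers_def)
    have "p \<notin> \<Union>A"
      using in_components_subset[OF comp] p by blast
    then obtain a b
      where ab: "\<And>H. H \<in> A \<Longrightarrow> a H \<noteq> 0 \<and> H = {x. a H \<bullet> x = b H} \<and> b H < a H \<bullet> p"
      using chamber_orientation[OF A] by metis
    interpret halfspace_system A a b
      by standard (use A ab in \<open>auto simp: hyperplane_arrangement_def\<close>)
    have p_open: "p \<in> open_region"
      using ab by (simp add: open_region_def)
    have C_eq: "C = open_region"
      using component_eq_open_region[OF comp p(1) p_open] .
    have clo: "closure C = region"
      unfolding C_eq using closure_open_region[OF p_open] .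
    have E: "affine (F q)"
      using gen q by (auto simp: generic_flag_def)
    obtain f c where f: "linear f" and hq: "h q = (\<lambda>x. f x + c)"
      using forms q Suc unfolding flag_forms_def by (metis atLeastAtMost_iff le_add1 plus_1_eq_Suc)
    have pos: "0 < h q y" if "y \<in> open_region \<inter> F q" for y
      using adm q Suc C that unfolding admissible_flag_forms_def C_eq by fastforce
    \<comment> \<open>Positivity on the open section passes to its boundary along segments from
      \<open>p\<close>, which stay inside \<open>F q\<close>.\<close>
    have nonneg: "0 \<le> f y + c" if y: "y \<in> region \<inter> F q" for y
    proof -
      obtain X where X: "\<forall>n. X n \<in> open_region \<and> (\<exists>t. X n = p + t *\<^sub>R (y - p))"
        "X \<longlonglongrightarrow> y"
        using region_limit[OF p_open, of y] y by blast
      have "X n \<in> F q" for n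
        using X(1)[rule_format, of n] affine_line_mem[OF E p(2)] y by auto
      then have "0 \<le> f (X n) + c" for n
        using pos[of "X n"] X(1) by (auto simp: hq less_imp_le)
      moreover have "(\<lambda>n. f (X n) + c) \<longlonglongrightarrow> f y + c"
        using f X(2)
        by (intro tendsto_add tendsto_const bounded_linear.tendsto[of f])
          (simp_all add: linear_conv_bounded_linear)
      ultimately show ?thesis
        by (intro LIMSEQ_le_const[of "\<lambda>n. f (X n) + c"]) auto
    qed
    have nonconst: "\<exists>u \<in> flat A y \<inter> F q. f u \<noteq> f y"
      if y: "y \<in> region \<inter> F q" "flat A y \<inter> F q \<noteq> {y}" for y
    proof -
      have "\<exists>u \<in> flat A y \<inter> F q. h q u \<noteq> h q y"
        unfolding Suc
        by (rule flag_form_nonconstant[OF gen forms _ flat_in_intersections])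
          (use q Suc y in \<open>auto simp: in_flat\<close>)
      then show ?thesis by (simp add: hq)
    qed
    \<comment> \<open>The second admissibility condition, in contrapositive form. It yields
      uniqueness of the vertex and then of the subspace.\<close>
    have sep: "X = X'"
      if "X \<in> intersections A" "X' \<in> intersections A" "X \<inter> F q = {x}" "X' \<inter> F q = {x'}"
        "h q x = h q x'" for X X' x x'
    proof (rule ccontr)
      assume "X \<noteq> X'"
      moreover have "aff_dim X = int CARD('n) - int q" "aff_dim X' = int CARD('n) - int q"
        using generic_flag_point_dim[OF gen q] that by blast+
      moreover have "q \<in> {1..CARD('n)}"
        using q Suc by simp
      ultimately have "h q ` (X \<inter> F q) \<noteq> h q ` (X' \<inter> F q)"
        using adm that(1,2) unfolding admissible_flag_forms_def by blast
      then show False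
        using that by simp
    qed
    have "\<exists>y \<in> region \<inter> F q. flat A y \<inter> F q = {y} \<and> (\<forall>x \<in> region \<inter> F q. f y \<le> f x)"
    proof (rule exists_minimal_vertex[OF E f nonneg nonconst])
      show "region \<inter> F q \<noteq> {}"
        using p clo closure_subset by blast
    qed
    then obtain v where v: "v \<in> region \<inter> F q" "flat A v \<inter> F q = {v}"
      "\<And>x. x \<in> region \<inter> F q \<Longrightarrow> f v \<le> f x"
      by blast
    have "min_vertex F h q C = v"
      unfolding min_vertex_def clo
    proof (rule the_equality)
      show "v extreme_point_of (region \<inter> F q) \<and> (\<forall>y\<in>region \<inter> F q. h q v \<le> h q y)"
        using v by (auto simp: extreme_point_iff_flat[OF E] hq)
      fix w
      assume w: "w extreme_point_of (region \<inter> F q) \<and> (\<forall>y\<in>region \<inter> F q. h q w \<le> h q y)"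
      then have w': "w \<in> region \<inter> F q" "flat A w \<inter> F q = {w}"
        by (auto simp: extreme_point_iff_flat[OF E])
      \<comment> \<open>Each of the two vertices minimizes \<open>h q\<close> on the
        section.\<close>
      then have "h q w = h q v"
        using w v(1,3) by (intro antisym) (auto simp: hq)
      then have "flat A w = flat A v"
        using sep[OF flat_in_intersections flat_in_intersections w'(2) v(2)] by simp
      then have "{w} = {v}"
        using w'(2) v(2) by argo
      then show "w = v" by blast
    qed
    then have "chamber_subspace A F h q C = (THE X. X \<in> intersections A \<and> X \<inter> F q = {v})"
      using Suc by (simp add: chamber_subspace_def)
    also have "\<dots> = flat A v"
    proof (rule the_equality)
      show "flat A v \<in> intersections A \<and> flat A v \<inter> F q = {v}"
        using flat_in_intersections v(2) by blast
      fix X assume "X \<in> intersections A \<and> X \<inter> F q = {v}"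
      then show "X = flat A v"
        using sep[OF _ flat_in_intersections _ v(2)] by blast
    qed
    finally have eq: "chamber_subspace A F h q C = flat A v" .
    show ?thesis
      unfolding eq
      using flat_in_intersections generic_flag_point_dim[OF gen q flat_in_intersections v(2)]
      by blast
  qed
  then show "chamber_subspace A F h q C \<in> intersections A"
    "aff_dim (chamber_subspace A F h q C) = int CARD('n) - int q"
    by auto
qed

section \<open>The stratum\<close>

lemma linear_complex_point: "linear (\<lambda>z. complex_point (fst z) (snd z))"
  by (rule linearI) (auto simp: complex_point_def vec_eq_iff complex_eq_iff algebra_simps)

lemma inj_complex_point: "inj (\<lambda>z. complex_point (fst z) (snd z))"
  by (rule injI) (auto simp: complex_point_def vec_eq_iff complex_eq_iff prod_eq_iff)

text \<open>The open half-space is convex, and a segment that leaves it crosses the boundary.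
  Equality is included because the closed segment contains \<open>x\<close>.\<close>

lemma Sep_iff:
  assumes "H \<in> A" "H = {x. a \<bullet> x = b}" "b < a \<bullet> p"
  shows "H \<in> Sep A p x \<longleftrightarrow> a \<bullet> x \<le> b"
proof
  assume "H \<in> Sep A p x"
  then obtain y where y: "y \<in> closed_segment p x" "a \<bullet> y = b"
    using assms by (auto simp: Sep_def)
  show "a \<bullet> x \<le> b"
  proof (rule ccontr)
    assume "\<not> a \<bullet> x \<le> b"
    then have "closed_segment p x \<subseteq> {x. b < a \<bullet> x}"
      using assms by (intro closed_segment_subset convex_halfspace_gt) auto
    then show False
      using y by auto
  qed
next
  assume "a \<bullet> x \<le> b"
  then show "H \<in> Sep A p x"
    using connected_ivt_hyperplane[of "closed_segment p x" x p a b] assms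
    by (auto simp: Sep_def)
qed

text \<open>First contract the \<open>x\<close>-coordinate to \<open>p\<close>, where no condition on \<open>v\<close> is left, and then
  contract \<open>T\<close> to the origin.\<close>

lemma contractible_halfspace_or_transversal:
  fixes p :: "'a::euclidean_space"
  assumes T: "subspace T" and p: "\<And>H. H \<in> A \<Longrightarrow> b H < a H \<bullet> p"
  shows "contractible {(x, v). v \<in> T \<and> (\<forall>H\<in>A. b H < a H \<bullet> x \<or> a H \<bullet> v \<noteq> 0)}"
    (is "contractible ?S")
proof -
  have "homotopic_with_canon (\<lambda>_. True) ?S ?S id (\<lambda>z. (p, snd z))"
  proof (rule homotopic_with_linear)
    fix z assume z: "z \<in> ?S"
    obtain x v where xv: "z = (x, v)" "v \<in> T"
      and H: "\<And>H. H \<in> A \<Longrightarrow> b H < a H \<bullet> x \<or> a H \<bullet> v \<noteq> 0"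
      using z by auto
    have "(1 - t) *\<^sub>R z + t *\<^sub>R (p, v) \<in> ?S" if t: "0 \<le> t" "t \<le> 1" for t
    proof -
      \<comment> \<open>The condition on \<open>x\<close> survives by convexity, since
        \<open>p\<close> satisfies it; the condition on \<open>v\<close> survives because
        \<open>v\<close> does not move.\<close>
      have "b H < a H \<bullet> ((1 - t) *\<^sub>R x + t *\<^sub>R p) \<or> a H \<bullet> v \<noteq> 0" if "H \<in> A" for H
        using H[OF that] p[OF that] t convexD_alt[OF convex_halfspace_gt[of "b H" "a H"], of x p t]
        by auto
      moreover have "(1 - t) *\<^sub>R v + t *\<^sub>R v = v"
        by (simp flip: scaleR_left_distrib)
      ultimately show ?thesis
        using xv by auto
    qed
    then show "closed_segment (id z) (p, snd z) \<subseteq> ?S"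
      using xv by (auto simp: closed_segment_def)
  qed (auto intro!: continuous_intros)
  moreover have "homotopic_with_canon (\<lambda>_. True) ?S ?S (\<lambda>z. (p, snd z)) (\<lambda>z. (p, 0))"
  proof (rule homotopic_with_linear)
    fix z assume "z \<in> ?S"
    then have "closed_segment (p, snd z) (p, 0) \<subseteq> {p} \<times> T"
      using T by (intro closed_segment_subset convex_Times)
        (auto simp: subspace_0 subspace_imp_convex)
    also have "\<dots> \<subseteq> ?S"
      using p by auto
    finally show "closed_segment (p, snd z) (p, 0) \<subseteq> ?S" .
  qed (auto intro!: continuous_intros)
  ultimately show ?thesis
    unfolding contractible_def using homotopic_with_trans by blast
qed

text \<open>Each of the finitely many alternatives is open in the full product; openness is relative
  only because of the constraint \<open>v \<in> T\<close>.\<close>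

lemma openin_halfspace_or_transversal:
  fixes T :: "'a::euclidean_space set"
  assumes "finite A"
  shows "openin (top_of_set (UNIV \<times> T))
    {(x, v). v \<in> T \<and> (\<forall>H\<in>A. b H < a H \<bullet> x \<or> a H \<bullet> v \<noteq> 0)}"
proof -
  have "open (\<Inter>H\<in>A. {z. b H < a H \<bullet> fst z} \<union> {z. a H \<bullet> snd z \<noteq> 0})"
    using assms
    by (auto intro!: open_INT open_Un open_Collect_less open_Collect_neq continuous_intros)
  moreover have "{(x, v). v \<in> T \<and> (\<forall>H\<in>A. b H < a H \<bullet> x \<or> a H \<bullet> v \<noteq> 0)}
    = (UNIV \<times> T) \<inter> (\<Inter>H\<in>A. {z. b H < a H \<bullet> fst z} \<union> {z. a H \<bullet> snd z \<noteq> 0})"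
    by auto
  ultimately show ?thesis
    by (simp add: openin_open_Int)
qed

theorem lemma3p9:
  fixes A :: "(real ^ 'n) set set"
    and F :: "nat \<Rightarrow> (real ^ 'n) set"
    and h :: "nat \<Rightarrow> real ^ 'n \<Rightarrow> real"
    and q :: nat
    and C :: "(real ^ 'n) set"
    and p :: "real ^ 'n"
  assumes "hyperplane_arrangement A"
    and "generic_flag A F"
    and "flag_forms F h"
    and "admissible_flag_forms A F h"
    and "q \<le> CARD('n)"
    and "C \<in> flag_chambers A F q"
    and "p \<in> C \<inter> F q"
  shows "stratum A F h q C p \<noteq> {} \<and>
         contractible (stratum A F h q C p) \<and>
         topological_manifold (2 * CARD('n) - q) (top_of_set (stratum A F h q C p))"
proof -
  define X where "X = chamber_subspace A F h q C"
  define T where "T = direction X"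
  have X: "X \<in> intersections A" "aff_dim X = int CARD('n) - int q"
    unfolding X_def using chamber_subspace_props assms(1-6) by blast+
  have "affine X" "X \<noteq> {}"
    using affine_intersection[OF assms(1) X(1)] X(1) by (auto simp: intersections_def)
  then have T: "subspace T" "dim T = CARD('n) - q"
    using direction_affine[of X] X(2) assms(5) by (auto simp: T_def)
  have "C \<in> components (UNIV - \<Union>A)"
    using assms(6) by (auto simp: flag_chambers_def chambers_def)
  then have "p \<notin> \<Union>A"
    using in_components_subset assms(7) by blast
  then obtain a b
    where ab: "\<And>H. H \<in> A \<Longrightarrow> a H \<noteq> 0 \<and> H = {x. a H \<bullet> x = b H} \<and> b H < a H \<bullet> p"
    using chamber_orientation[OF assms(1)] by metis
  define f :: "(real ^ 'n) \<times> (real ^ 'n) \<Rightarrow> complex ^ 'n"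
    where "f = (\<lambda>z. complex_point (fst z) (snd z))"
  \<comment> \<open>The stratum in real coordinates, with separation replaced by the oriented
    inequalities.\<close>
  define S where "S = {(x, v). v \<in> T \<and> (\<forall>H\<in>A. b H < a H \<bullet> x \<or> a H \<bullet> v \<noteq> 0)}"
  have Sep: "(\<forall>H \<in> Sep A p x. v \<notin> direction H) \<longleftrightarrow> (\<forall>H\<in>A. b H < a H \<bullet> x \<or> a H \<bullet> v \<noteq> 0)"
    for x v
  proof -
    have "H \<in> Sep A p x \<longleftrightarrow> a H \<bullet> x \<le> b H" if "H \<in> A" for H
      using Sep_iff[OF that] ab[OF that] by blast
    then have "Sep A p x = {H \<in> A. a H \<bullet> x \<le> b H}"
      by (auto simp: Sep_def)
    moreover have "direction H = {x. a H \<bullet> x = 0}" if "H \<in> A" for H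
      using ab[OF that] direction_hyperplane[of "a H" "b H"] by metis
    ultimately show ?thesis
      by (auto simp: not_less)
  qed
  have stratum: "stratum A F h q C p = f ` S"
  proof -
    have "stratum A F h q C p = {f (x, v) |x v. (x, v) \<in> S}"
      unfolding stratum_def Sep by (simp add: S_def f_def T_def X_def)
    then show ?thesis by auto
  qed
  have "(p, 0) \<in> S"
    using ab T(1) by (auto simp: S_def subspace_0)
  then have "f ` S \<noteq> {}"
    by blast
  moreover have "contractible (f ` S)"
  proof (rule homeomorphic_contractible)
    show "contractible S"
      unfolding S_def
      by (rule contractible_halfspace_or_transversal[where p = p, OF T(1)]) (simp add: ab)
    show "S homeomorphic f ` S"
      unfolding f_def
      by (rule linear_homeomorphic_image[OF linear_complex_point inj_complex_point])
  qed
  moreover have "topological_manifold (2 * CARD('n) - q) (top_of_set (f ` S))"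
  proof -
    have "finite A"
      using assms(1) by (simp add: hyperplane_arrangement_def)
    then have "openin (top_of_set (UNIV \<times> T)) S"
      unfolding S_def by (rule openin_halfspace_or_transversal)
    then have "topological_manifold (dim ((UNIV :: (real ^ 'n) set) \<times> T)) (top_of_set (f ` S))"
      unfolding f_def
      by (intro topological_manifold_linear_image linear_complex_point inj_complex_point
          subspace_Times subspace_UNIV T(1))
    \<comment> \<open>The sum of \<open>CARD('n)\<close> and \<open>CARD('n) - q\<close>; the bound
      on \<open>q\<close> keeps the natural subtraction exact.\<close>
    moreover have "dim ((UNIV :: (real ^ 'n) set) \<times> T) = 2 * CARD('n) - q"
      using T assms(5) by (simp add: dim_Times)
    ultimately show ?thesis by simp
  qed
  ultimately show ?thesis
    unfolding stratum by blast
qed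

end
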